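(* Let $G$ be a subcubic graph with $\mathrm{mad}(G)<\frac{9}{4}$. Then $\chi_{DP}(G^2)\le 5$.
   Context: All graphs are finite and simple. A graph $G$ is subcubic if its maximum degree is at most $3$. The square $G^2$ is the graph obtained from $G$ by adding an edge between every pair of vertices at distance $2$ in $G$. The maximum average degree is $\mathrm{mad}(G)=\max_{H\subseteq G}\frac{2|E(H)|}{|V(H)|}$, over (nonempty) subgraphs $H$ of $G$. DP-coloring. Let $G=(V,E)$ be a graph and $L$ a list assignment (a set $L(u)$ of colors for each $u\in V$). A cover $H_L$ of $G$ is a graph such that: (1) $V(H_L)=\{(u,c):u\in V,\ c\in L(u)\}$; (2) for each $u$, the set $\{u\}\times L(u)$ induces a clique; (3) for each edge $uv\in E$, the edges of $H_L$ between $\{u\}\times L(u)$ and $\{v\}\times L(v)$ form a (possibly empty) matching $M_{uv}$; (4) for distinct $u,v$ with $uv\notin E$, there are no edges of $H_L$ between $\{u\}\times L(u)$ and $\{v\}\times L(v)$. The graph $G$ is DP-$k$-colorable if for every list assignment $L$ with $|L(u)|\ge k$ for all $u\in V$, every cover $H_L$ (i.e. every choice of matchings) contains an independent set $I$ with $|I|=|V|$. The DP-chromatic number $\chi_{DP}(G)$ is the minimum $k$ such that $G$ is DP-$k$-colorable. *)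

theory Defs
  imports Complex_Main "HOL-Library.Disjoint_Sets" "Graph_Theory.Graph_Theory"
begin

text \<open>
  A finite simple graph is a \<^locale>\<open>pair_graph\<close>: finitely many vertices and a symmetric,
  irreflexive set of arcs.  Each undirected edge is represented by two opposite arcs.
\<close>

definition uedges :: "'a pair_pre_digraph \<Rightarrow> 'a set set" where
  "uedges G = {{u, v} | u v. (u, v) \<in> parcs G}"

text \<open>Because arcs come in opposite pairs, the out-degree is the degree.\<close>

definition subcubic :: "'a pair_pre_digraph \<Rightarrow> bool" where
  "subcubic G \<longleftrightarrow> (\<forall>v \<in> pverts G. out_degree (with_proj G) v \<le> 3)"

text \<open>
  For a finite graph with at least one vertex the set below is finite and nonempty.  For the
  graph without vertices the value is unspecified.
\<close>

definition mad :: "'a pair_pre_digraph \<Rightarrow> real" where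
  "mad G = Max {2 * real (card (uedges H)) / real (card (pverts H)) | H.
     pair_graph H \<and> subgraph (with_proj H) (with_proj G) \<and> pverts H \<noteq> {}}"

text \<open>The distance is the least cost of a walk in which every arc costs 1.\<close>

definition graph_dist :: "'a pair_pre_digraph \<Rightarrow> 'a \<Rightarrow> 'a \<Rightarrow> ereal" where
  "graph_dist G u v = wf_digraph.\<mu> (with_proj G) (\<lambda>_. 1) u v"

definition square :: "'a pair_pre_digraph \<Rightarrow> 'a pair_pre_digraph" where
  "square G = \<lparr> pverts = pverts G,
     parcs = parcs G \<union> {(u, v). u \<in> pverts G \<and> v \<in> pverts G \<and> graph_dist G u v = 2} \<rparr>"

definition is_clique :: "'a pair_pre_digraph \<Rightarrow> 'a set \<Rightarrow> bool" where
  "is_clique G A \<longleftrightarrow> A \<subseteq> pverts G \<and> (\<forall>x \<in> A. \<forall>y \<in> A. x \<noteq> y \<longrightarrow> (x, y) \<in> parcs G)"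

definition independent_set :: "'a pair_pre_digraph \<Rightarrow> 'a set \<Rightarrow> bool" where
  "independent_set G A \<longleftrightarrow> A \<subseteq> pverts G \<and> (\<forall>x \<in> A. \<forall>y \<in> A. (x, y) \<notin> parcs G)"

definition edges_between :: "'a pair_pre_digraph \<Rightarrow> 'a set \<Rightarrow> 'a set \<Rightarrow> 'a set set" where
  "edges_between G A B = {e \<in> uedges G. \<exists>a \<in> A. \<exists>b \<in> B. e = {a, b}}"

text \<open>
  A set of edges is a matching iff distinct edges share no endpoint, that is, iff it is
  \<^const>\<open>disjoint\<close> as a family of sets.

  Being a \<^locale>\<open>pair_graph\<close>, a cover is finite, so \<open>L u\<close> is finite at every vertex \<open>u\<close>
  whenever a cover for \<open>L\<close> exists.
\<close>

definition is_cover ::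
  "'a pair_pre_digraph \<Rightarrow> ('a \<Rightarrow> 'c set) \<Rightarrow> ('a \<times> 'c) pair_pre_digraph \<Rightarrow> bool" where
  "is_cover G L H \<longleftrightarrow> pair_graph H \<and>
     pverts H = (SIGMA u : pverts G. L u) \<and>
     (\<forall>u \<in> pverts G. is_clique H ({u} \<times> L u)) \<and>
     (\<forall>(u, v) \<in> parcs G. disjoint (edges_between H ({u} \<times> L u) ({v} \<times> L v))) \<and>
     (\<forall>u \<in> pverts G. \<forall>v \<in> pverts G. u \<noteq> v \<and> (u, v) \<notin> parcs G \<longrightarrow>
        edges_between H ({u} \<times> L u) ({v} \<times> L v) = {})"

text \<open>
  A definition cannot quantify over types, so the type \<open>'c\<close> of colors is an explicit parameter.
  Since the lists of a cover are finite, all infinite types \<open>'c\<close> yield the same notion; a finite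
  \<open>'c\<close> only restricts the available lists.

  If every list has at least \<open>card (pverts G)\<close> colors, an independent set as required can be
  chosen greedily, so the minimum in the DP-chromatic number is attained.
\<close>

definition dp_colorable :: "'c itself \<Rightarrow> nat \<Rightarrow> 'a pair_pre_digraph \<Rightarrow> bool" where
  "dp_colorable (_ :: 'c itself) k G \<longleftrightarrow>
     (\<forall>L :: 'a \<Rightarrow> 'c set. (\<forall>u \<in> pverts G. k \<le> card (L u)) \<longrightarrow>
       (\<forall>H. is_cover G L H \<longrightarrow> (\<exists>I. independent_set H I \<and> card I = card (pverts G))))"

definition dp_chromatic_number :: "'c itself \<Rightarrow> 'a pair_pre_digraph \<Rightarrow> nat" where
  "dp_chromatic_number (T :: 'c itself) G = (LEAST k. dp_colorable T k G)"

end

theory Submission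
  imports Defs
begin

text \<open>
  The square of \<open>G\<close> turns out to be 4-degenerate: its vertices can be listed so that each has at
  most four neighbours in the square that come earlier.  Five colours then suffice greedily, also
  for DP-coloring: since the cover has only a matching over each edge, each coloured neighbour
  forbids at most one colour of a vertex's list (\<open>degenerate_imp_dp_colorable\<close>).

  The ordering is built by removing vertices of \<open>G\<close>.  Suppose that all degrees in a subgraph are 2
  or 3 and that every vertex of degree 2 has a neighbour of degree 3.  Each vertex of degree 3 has
  at most three neighbours of degree 2, so there are at most three times as many vertices of degree
  2 as of degree 3, and the average degree is at least \<open>(3 + 3 \<cdot> 2) / 4 = 9/4\<close>.  Hence, when the
  maximum average degree is below \<open>9/4\<close>, each nonempty subgraph contains a vertex of degree at most
  1, or a vertex \<open>v\<close> of degree 2 whose neighbours \<open>a\<close> and \<open>b\<close> both have degree 2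
  (\<open>sparse_vertex_exists\<close>).

  In the first case the vertex is removed; it sees at most \<open>1 + 2\<close> vertices within distance two.  In
  the second case \<open>a\<close>, \<open>v\<close> and \<open>b\<close> are removed together.  They are then put back in the order \<open>a\<close>,
  \<open>b\<close>, \<open>v\<close>: outside \<open>{a, v, b}\<close>, each of \<open>a\<close> and \<open>b\<close> sees at most one neighbour and that
  neighbour's two others, so \<open>a\<close> meets at most three earlier vertices and \<open>b\<close> at most four, and \<open>v\<close>
  sees in total only \<open>a\<close>, \<open>b\<close> and their two other neighbours (\<open>degenerate_within_two\<close>).  Taking out
  all three at once matters: removing \<open>v\<close> alone would destroy the path that puts \<open>a\<close> and \<open>b\<close> at
  distance two, whereas each of the three removed vertices has at most one remaining neighbour, so
  that no two remaining vertices lose their connection.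
\<close>

section \<open>Greedy DP-coloring of degenerate graphs\<close>

inductive degenerate :: "nat \<Rightarrow> ('a \<times> 'a) set \<Rightarrow> 'a set \<Rightarrow> bool" for k R where
  empty: "degenerate k R {}"
| insert: "degenerate k R W \<Longrightarrow> v \<notin> W \<Longrightarrow> card (R `` {v} \<inter> W) \<le> k \<Longrightarrow> degenerate k R (insert v W)"

lemma degenerate_finite: "degenerate k R W \<Longrightarrow> finite W"
  by (induction rule: degenerate.induct) auto

text \<open>
  Only pairs of distinct vertices matter, because a vertex is never counted among its own
  predecessors.  So the loops in \<open>E O E\<close> are harmless, although a loop can disappear when its
  midpoint is deleted.
\<close>

lemma degenerate_mono:
  assumes "degenerate k S W"
    and "\<And>u w. u \<in> W \<Longrightarrow> w \<in> W \<Longrightarrow> u \<noteq> w \<Longrightarrow> (u, w) \<in> R \<Longrightarrow> (u, w) \<in> S"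
  shows "degenerate k R W"
  using assms
proof (induction rule: degenerate.induct)
  case empty
  show ?case by (rule degenerate.empty)
next
  case (insert W v)
  have "R `` {v} \<inter> W \<subseteq> S `` {v} \<inter> W"
    using insert.prems insert.hyps(2) by auto
  then have "card (R `` {v} \<inter> W) \<le> card (S `` {v} \<inter> W)"
    using degenerate_finite[OF insert.hyps(1)] by (intro card_mono) auto
  then show ?case
    using insert by (intro degenerate.insert) auto
qed

lemma cover_conflict_unique:
  assumes "is_cover Q L H" and "(v, u) \<in> parcs Q" and "u \<noteq> v"
    and "c \<in> L v" "c' \<in> L v" "d \<in> L u"
    and "((v, c), (u, d)) \<in> parcs H" "((v, c'), (u, d)) \<in> parcs H"
  shows "c = c'"
proof -
  let ?M = "edges_between H ({v} \<times> L v) ({u} \<times> L u)"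
  have "disjoint ?M"
    using assms(1,2) by (auto simp: is_cover_def)
  moreover have "{(v, c), (u, d)} \<in> ?M" "{(v, c'), (u, d)} \<in> ?M"
    using assms(4-) by (auto simp: edges_between_def uedges_def)
  moreover have "{(v, c), (u, d)} \<inter> {(v, c'), (u, d)} \<noteq> {}"
    by simp
  ultimately have "{(v, c), (u, d)} = {(v, c'), (u, d)}"
    by (metis disjointD)
  with \<open>u \<noteq> v\<close> show ?thesis
    by (auto simp: doubleton_eq_iff)
qed

lemma cover_conflict_adjacent:
  assumes "is_cover Q L H" and "v \<in> pverts Q" "u \<in> pverts Q" and "u \<noteq> v"
    and "c \<in> L v" "d \<in> L u" and "((v, c), (u, d)) \<in> parcs H"
  shows "(v, u) \<in> parcs Q"
proof (rule ccontr)
  assume "(v, u) \<notin> parcs Q"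
  then have "edges_between H ({v} \<times> L v) ({u} \<times> L u) = {}"
    using assms(1-4) by (auto simp: is_cover_def)
  moreover have "{(v, c), (u, d)} \<in> edges_between H ({v} \<times> L v) ({u} \<times> L u)"
    using assms(5-) by (auto simp: edges_between_def uedges_def)
  ultimately show False by simp
qed

text \<open>
  The greedy step: a colour of \<open>v\<close> can be blocked only by an earlier neighbour in \<open>Q\<close>, and the
  matching over that edge lets the neighbour's chosen colour block at most one colour.
\<close>

lemma degenerate_transversal:
  assumes "degenerate k (parcs Q) W"
    and "is_cover Q L H" and "W \<subseteq> pverts Q"
    and "\<And>u. u \<in> pverts Q \<Longrightarrow> k < card (L u)"
  shows "\<exists>f. (\<forall>u \<in> W. f u \<in> L u) \<and> (\<forall>u \<in> W. \<forall>w \<in> W. ((u, f u), (w, f w)) \<notin> parcs H)"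
  using assms
proof (induction rule: degenerate.induct)
  case empty
  show ?case by simp
next
  case (insert W v)
  interpret H: pair_graph H
    using insert.prems by (simp add: is_cover_def)
  have "\<exists>f. (\<forall>u \<in> W. f u \<in> L u) \<and> (\<forall>u \<in> W. \<forall>w \<in> W. ((u, f u), (w, f w)) \<notin> parcs H)"
    using insert.prems by (intro insert.IH) auto
  then obtain f where f: "\<And>u. u \<in> W \<Longrightarrow> f u \<in> L u"
    and indep: "\<And>u w. u \<in> W \<Longrightarrow> w \<in> W \<Longrightarrow> ((u, f u), (w, f w)) \<notin> parcs H"
    by blast
  define N where "N = parcs Q `` {v} \<inter> W"
  \<comment> \<open>the colours of \<open>v\<close> blocked by the choice at \<open>u\<close>\<close>
  define B where "B u = {c \<in> L v. ((v, c), (u, f u)) \<in> parcs H}" for u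
  have v: "v \<in> pverts Q" "k < card (L v)"
    using insert.prems by auto
  have finN: "finite N"
    using degenerate_finite[OF insert.hyps(1)] by (simp add: N_def)
  have B1: "card (B u) \<le> 1" if "u \<in> N" for u
  proof -
    have "c = c'" if "c \<in> B u" "c' \<in> B u" for c c'
      using that \<open>u \<in> N\<close> insert.hyps(2) f
      by (intro cover_conflict_unique[OF insert.prems(1), of v u c c' "f u"])
         (auto simp: B_def N_def)
    then show ?thesis
      by (metis card_le_Suc0_iff_eq card.infinite One_nat_def zero_le_one)
  qed
  have "card (\<Union>u \<in> N. B u) \<le> (\<Sum>u \<in> N. card (B u))"
    by (rule card_UN_le[OF finN])
  also have "\<dots> \<le> card N"
    using sum_mono[of N "\<lambda>u. card (B u)" "\<lambda>_. 1"] B1 by simp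
  also have "\<dots> < card (L v)"
    using insert.hyps(3) v(2) by (simp add: N_def)
  finally have less: "card (\<Union>u \<in> N. B u) < card (L v)" .
  have "finite (\<Union>u \<in> N. B u)"
    using finN card_ge_0_finite[of "L v"] v(2) by (auto simp: B_def)
  then have "\<not> L v \<subseteq> (\<Union>u \<in> N. B u)"
    using less card_mono leD by blast
  then obtain c where c: "c \<in> L v" "\<And>u. u \<in> N \<Longrightarrow> c \<notin> B u"
    by auto
  have free: "((v, c), (u, f u)) \<notin> parcs H" if "u \<in> W" for u
  proof
    assume arc: "((v, c), (u, f u)) \<in> parcs H"
    have "u \<noteq> v" using that insert.hyps(2) by auto
    then have "(v, u) \<in> parcs Q"
      using cover_conflict_adjacent[OF insert.prems(1) v(1) _ _ c(1) f arc] that insert.prems(2)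
      by auto
    then show False
      using c that arc by (auto simp: N_def B_def)
  qed
  have sym: "((u, f u), (v, c)) \<notin> parcs H" if "u \<in> W" for u
    using free[OF that] H.pair_sym_arcs by (auto simp: symmetric_def dest: symD)
  have "((v, c), (v, c)) \<notin> parcs H"
    using H.pair_no_loops by fastforce
  then show ?case
    using f indep free sym c(1) insert.hyps(2)
    by (intro exI[of _ "f(v := c)"]) auto
qed

lemma degenerate_imp_dp_colorable:
  fixes Q :: "'a pair_pre_digraph"
  assumes "degenerate k (parcs Q) (pverts Q)"
  shows "dp_colorable TYPE('c) (Suc k) Q"
  unfolding dp_colorable_def
proof (intro allI impI)
  fix L :: "'a \<Rightarrow> 'c set" and H
  assume L: "\<forall>u \<in> pverts Q. Suc k \<le> card (L u)" and H: "is_cover Q L H"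
  then obtain f where f: "\<forall>u \<in> pverts Q. f u \<in> L u"
    "\<forall>u \<in> pverts Q. \<forall>w \<in> pverts Q. ((u, f u), (w, f w)) \<notin> parcs H"
    using degenerate_transversal[OF assms H] by fastforce
  let ?I = "(\<lambda>u. (u, f u)) ` pverts Q"
  have "independent_set H ?I"
    using f H by (auto simp: independent_set_def is_cover_def)
  moreover have "card ?I = card (pverts Q)"
    by (intro card_image inj_onI) simp
  ultimately show "\<exists>I. independent_set H I \<and> card I = card (pverts Q)"
    by blast
qed

section \<open>Sparse places in graphs of average degree below 9/4\<close>

text \<open>
  A graph is here a symmetric relation, so \<open>card E\<close> is the sum of the degrees and the last
  hypothesis says that the average degree is below \<open>9/4\<close>.  If the claim fails, every vertex of
  degree 2 is a neighbour of a vertex of degree 3, and covering the former by the neighbourhoods of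
  the latter gives the bound that contradicts it.
\<close>

lemma sparse_vertex_exists:
  assumes "finite W" and "E \<subseteq> W \<times> W" and "sym E"
    and deg3: "\<And>v. v \<in> W \<Longrightarrow> card (E `` {v}) \<le> 3"
    and sparse: "4 * card E < 9 * card W"
  shows "\<exists>v \<in> W. card (E `` {v}) \<le> 1 \<or>
    card (E `` {v}) = 2 \<and> (\<forall>u \<in> E `` {v}. card (E `` {u}) = 2)"
proof (rule ccontr)
  assume neg: "\<not> ?thesis"
  define A where "A = {v \<in> W. card (E `` {v}) = 2}"
  define B where "B = {v \<in> W. card (E `` {v}) = 3}"
  have fin: "finite A" "finite B"
    using assms(1) by (auto simp: A_def B_def)
  have deg: "card (E `` {v}) = 2 \<or> card (E `` {v}) = 3" if "v \<in> W" for v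
    using neg deg3[OF that] that by force
  then have W: "W = A \<union> B" and AB: "A \<inter> B = {}"
    by (auto simp: A_def B_def)
  have finE: "finite (E `` {v})" for v
    using assms(1,2) by (auto intro: finite_subset[of _ W])
  have "A \<subseteq> (\<Union>b \<in> B. E `` {b})"
  proof
    fix a assume a: "a \<in> A"
    then obtain u where u: "(a, u) \<in> E" "card (E `` {u}) \<noteq> 2"
      using neg by (auto simp: A_def)
    then have "u \<in> B"
      using deg[of u] assms(2) by (auto simp: B_def)
    with u assms(3) show "a \<in> (\<Union>b \<in> B. E `` {b})"
      by (auto dest: symD)
  qed
  then have "card A \<le> card (\<Union>b \<in> B. E `` {b})"
    using fin finE by (intro card_mono) auto
  also have "\<dots> \<le> (\<Sum>b \<in> B. card (E `` {b}))"
    by (rule card_UN_le[OF fin(2)])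
  also have "\<dots> = 3 * card B"
    by (simp add: B_def)
  finally have "card A \<le> 3 * card B" .
  moreover have "card E = 2 * card A + 3 * card B"
  proof -
    have "E = Sigma W (\<lambda>v. E `` {v})"
      using assms(2) by auto
    then have "card E = (\<Sum>v \<in> W. card (E `` {v}))"
      using assms(1) finE by (metis card_SigmaI)
    also have "\<dots> = (\<Sum>v \<in> A. card (E `` {v})) + (\<Sum>v \<in> B. card (E `` {v}))"
      unfolding W by (rule sum.union_disjoint[OF fin AB])
    also have "\<dots> = 2 * card A + 3 * card B"
      by (simp add: A_def B_def)
    finally show ?thesis .
  qed
  moreover have "card W = card A + card B"
    unfolding W by (rule card_Un_disjoint[OF fin AB])
  ultimately show False
    using sparse by simp
qed

section \<open>Degeneracy of the square\<close>

definition within_two :: "('a \<times> 'a) set \<Rightarrow> ('a \<times> 'a) set" where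
  "within_two E = E \<union> E O E"

text \<open>
  Passing to an induced subgraph loses no pair as long as the removed vertices are not midpoints of
  paths between distinct remaining vertices.
\<close>

lemma within_two_restrict:
  assumes "(u, w) \<in> within_two E" and "u \<noteq> w" and "u \<in> X" "w \<in> X"
    and "\<And>x. x \<notin> X \<Longrightarrow> (u, x) \<in> E \<Longrightarrow> (x, w) \<in> E \<Longrightarrow> u = w"
  shows "(u, w) \<in> within_two (E \<inter> X \<times> X)"
  using assms unfolding within_two_def by blast

text \<open>
  Every vertex of \<open>X\<close> within two steps of \<open>v\<close> is reached through \<open>N\<close>, and each \<open>u \<in> N\<close> leads to at
  most \<open>d u\<close> further vertices, as one of its neighbours is \<open>v\<close> itself.  \<open>N\<close> may be smaller than
  the neighbourhood of \<open>v\<close> when the other neighbours and what lies behind them avoid \<open>X\<close>.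
\<close>

lemma card_within_two_le:
  assumes "finite N" and "N \<subseteq> E `` {v}" and "sym E"
    and "within_two E `` {v} \<inter> X \<subseteq> N \<union> (\<Union>u \<in> N. E `` {u})" and "v \<notin> X"
    and "\<And>u. u \<in> N \<Longrightarrow> card (E `` {u}) \<le> Suc (d u)" and "\<And>u. finite (E `` {u})"
  shows "card (within_two E `` {v} \<inter> X) \<le> card N + (\<Sum>u \<in> N. d u)"
proof -
  have "within_two E `` {v} \<inter> X \<subseteq> N \<union> (\<Union>u \<in> N. E `` {u} - {v})"
    using assms(4,5) by auto
  then have "card (within_two E `` {v} \<inter> X) \<le> card (N \<union> (\<Union>u \<in> N. E `` {u} - {v}))"
    using assms(1,7) by (intro card_mono) auto
  also have "\<dots> \<le> card N + card (\<Union>u \<in> N. E `` {u} - {v})"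
    by (rule card_Un_le)
  also have "card (\<Union>u \<in> N. E `` {u} - {v}) \<le> (\<Sum>u \<in> N. card (E `` {u} - {v}))"
    by (rule card_UN_le[OF assms(1)])
  also have "\<dots> \<le> (\<Sum>u \<in> N. d u)"
  proof (rule sum_mono)
    fix u assume u: "u \<in> N"
    then have "v \<in> E `` {u}"
      using assms(2,3) by (auto dest: symD)
    then show "card (E `` {u} - {v}) \<le> d u"
      using assms(6)[OF u] assms(7)[of u] by (simp add: card_Diff_singleton)
  qed
  finally show ?thesis by simp
qed

text \<open>
  The sparsity hypothesis is about all induced subgraphs because the induction deletes vertices.
  \<open>F\<close> is the current induced subgraph.  In the second case \<open>a\<close> and \<open>b\<close> may be adjacent, or may
  have the same second neighbour; the upper bounds below hold in these cases too.
\<close>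

lemma degenerate_within_two:
  assumes "finite W" and "sym E" and "irrefl E"
    and "\<And>v. v \<in> W \<Longrightarrow> card (E `` {v} \<inter> W) \<le> 3"
    and "\<And>X. X \<subseteq> W \<Longrightarrow> X \<noteq> {} \<Longrightarrow> 4 * card (E \<inter> X \<times> X) < 9 * card X"
  shows "degenerate 4 (within_two (E \<inter> W \<times> W)) W"
  using assms
proof (induction W rule: finite_psubset_induct)
  case (psubset W)
  show ?case
  proof (cases "W = {}")
    case True
    then show ?thesis by (simp add: degenerate.empty)
  next
    case False
    define F where "F = E \<inter> W \<times> W"
    have FW: "F \<subseteq> W \<times> W" by (simp add: F_def)
    have sym: "sym F"
      using psubset.prems(1) by (auto simp: F_def sym_def)
    have irr: "u \<noteq> w" if "(u, w) \<in> F" for u w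
      using that psubset.prems(2) by (auto simp: F_def irrefl_def)
    have fin: "finite (F `` {v})" for v
      using psubset.hyps(1) FW by (auto intro: finite_subset[of _ W])
    have deg3: "card (F `` {v}) \<le> 3" for v
    proof (cases "v \<in> W")
      case True
      then have "F `` {v} = E `` {v} \<inter> W" by (auto simp: F_def)
      then show ?thesis using psubset.prems(3)[OF True] by simp
    next
      case False
      then have "F `` {v} = {}" by (auto simp: F_def)
      then show ?thesis by simp
    qed
    have IH: "degenerate 4 (within_two F) X"
      if "X \<subset> W" and one: "\<And>x u w. x \<in> W - X \<Longrightarrow> u \<in> X \<Longrightarrow> w \<in> X \<Longrightarrow>
          (x, u) \<in> F \<Longrightarrow> (x, w) \<in> F \<Longrightarrow> u = w" for X
    proof (rule degenerate_mono)
      show "degenerate 4 (within_two (E \<inter> X \<times> X)) X"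
      proof (rule psubset.IH[OF \<open>X \<subset> W\<close> psubset.prems(1,2)])
        fix v assume "v \<in> X"
        then have "card (E `` {v} \<inter> X) \<le> card (E `` {v} \<inter> W)"
          using \<open>X \<subset> W\<close> psubset.hyps(1) by (intro card_mono) auto
        also have "\<dots> \<le> 3"
          using psubset.prems(3) \<open>v \<in> X\<close> \<open>X \<subset> W\<close> by auto
        finally show "card (E `` {v} \<inter> X) \<le> 3" .
      next
        fix Y assume "Y \<subseteq> X" "Y \<noteq> {}"
        then show "4 * card (E \<inter> Y \<times> Y) < 9 * card Y"
          using psubset.prems(4)[of Y] \<open>X \<subset> W\<close> by auto
      qed
      fix u w assume uw: "u \<in> X" "w \<in> X" "u \<noteq> w" "(u, w) \<in> within_two F"
      have "(u, w) \<in> within_two (F \<inter> X \<times> X)"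
      proof (rule within_two_restrict[OF uw(4,3,1,2)])
        fix x assume x: "x \<notin> X" "(u, x) \<in> F" "(x, w) \<in> F"
        then have "(x, u) \<in> F" "x \<in> W"
          using sym FW by (auto dest: symD)
        then show "u = w"
          using one[of x u w] uw(1,2) x by blast
      qed
      moreover have "F \<inter> X \<times> X = E \<inter> X \<times> X"
        using \<open>X \<subset> W\<close> by (auto simp: F_def)
      ultimately show "(u, w) \<in> within_two (E \<inter> X \<times> X)" by simp
    qed
    obtain v where v: "v \<in> W" and cases: "card (F `` {v}) \<le> 1 \<or>
        card (F `` {v}) = 2 \<and> (\<forall>u \<in> F `` {v}. card (F `` {u}) = 2)"
      using sparse_vertex_exists[OF psubset.hyps(1) FW sym] deg3
        psubset.prems(4)[of W] False by (auto simp: F_def)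
    from cases show ?thesis
    proof (elim disjE conjE)
      assume le1: "card (F `` {v}) \<le> 1"
      have "degenerate 4 (within_two F) (W - {v})"
      proof (rule IH)
        fix x u w assume "x \<in> W - (W - {v})" "(x, u) \<in> F" "(x, w) \<in> F"
        then show "u = w"
          using le1 fin[of v] by (auto simp: card_le_Suc0_iff_eq)
      qed (use v in auto)
      moreover have "card (within_two F `` {v} \<inter> (W - {v})) \<le> 4"
      proof -
        have "card (within_two F `` {v} \<inter> (W - {v})) \<le> card (F `` {v}) + (\<Sum>u \<in> F `` {v}. 2)"
          by (rule card_within_two_le[OF fin _ sym])
             (use deg3 fin in \<open>auto simp: within_two_def numeral_3_eq_3 numeral_2_eq_2\<close>)
        also have "\<dots> \<le> 4" using le1 by simp
        finally show ?thesis .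
      qed
      ultimately have "degenerate 4 (within_two F) (insert v (W - {v}))"
        by (intro degenerate.insert) auto
      then show ?thesis
        using v by (simp add: F_def insert_absorb)
    next
      assume "card (F `` {v}) = 2" and all2: "\<forall>u \<in> F `` {v}. card (F `` {u}) = 2"
      then obtain a b where Nv: "F `` {v} = {a, b}" and ab: "a \<noteq> b"
        by (auto simp: card_2_iff)
      have va: "(v, a) \<in> F" "(a, v) \<in> F" and vb: "(v, b) \<in> F" "(b, v) \<in> F"
        using Nv sym by (auto dest: symD)
      have deg2: "card (F `` {a}) = 2" "card (F `` {b}) = 2"
        using all2 Nv by auto
      have other: "\<exists>y. F `` {x} = {v, y}"
        if two: "card (F `` {x}) = 2" and xv: "(x, v) \<in> F" for x
      proof -
        obtain y z where yz: "F `` {x} = {y, z}"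
          using two by (auto simp: card_2_iff)
        have "v \<in> F `` {x}" using xv by simp
        then have "v = y \<or> v = z" by (simp only: yz insert_iff empty_iff simp_thms)
        then show ?thesis using yz by (metis insert_commute)
      qed
      obtain a' where Na: "F `` {a} = {v, a'}" using other deg2 va by blast
      obtain b' where Nb: "F `` {b} = {v, b'}" using other deg2 vb by blast
      have distinct: "v \<noteq> a" "v \<noteq> b" using irr va vb by auto
      have inW: "a \<in> W" "b \<in> W" using va vb FW by auto
      define X where "X = W - {v, a, b}"
      have degX: "degenerate 4 (within_two F) X"
      proof (rule IH)
        show "X \<subset> W" using v by (auto simp: X_def)
        fix x u w
        assume "x \<in> W - X" "u \<in> X" "w \<in> X" and F: "(x, u) \<in> F" "(x, w) \<in> F"
        then have "x = v \<or> x = a \<or> x = b" and "u \<notin> {v, a, b}" "w \<notin> {v, a, b}"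
          by (auto simp: X_def)
        moreover have "u \<in> F `` {x}" "w \<in> F `` {x}"
          using F by auto
        ultimately show "u = w"
          by (elim disjE) (auto simp: Nv Na Nb simp del: Image_singleton_iff)
      qed
      \<comment> \<open>Seen from an end \<open>x\<close> of the path \<open>a, v, b\<close>, the way through \<open>v\<close> only leads to the other end,
        so \<open>X\<close> is reached through the second neighbour \<open>y\<close> alone.\<close>
      have step: "card (within_two F `` {x} \<inter> X) \<le> 3"
        if "F `` {x} = {v, y}" "x \<in> {a, b}" for x y
      proof -
        have "(x, y) \<in> F" using that by auto
        have "card (within_two F `` {x} \<inter> X) \<le> card {y} + (\<Sum>u \<in> {y}. 2)"
        proof (rule card_within_two_le[OF _ _ sym])
          show "{y} \<subseteq> F `` {x}" using that by auto
          show "within_two F `` {x} \<inter> X \<subseteq> {y} \<union> (\<Union>u \<in> {y}. F `` {u})"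
          proof
            fix z assume z: "z \<in> within_two F `` {x} \<inter> X"
            then consider "z \<in> F `` {x}" | u where "u \<in> F `` {x}" "z \<in> F `` {u}"
              by (auto simp: within_two_def)
            then show "z \<in> {y} \<union> (\<Union>u \<in> {y}. F `` {u})"
              by cases (use that z Nv in \<open>auto simp: X_def\<close>)
          qed
          show "x \<notin> X" using that by (auto simp: X_def)
        qed (use deg3 fin in \<open>auto simp: numeral_3_eq_3 numeral_2_eq_2\<close>)
        then show ?thesis by simp
      qed
      have "degenerate 4 (within_two F) (insert a X)"
        using degX step[OF Na]
        by - (rule degenerate.insert, auto simp: X_def)
      moreover have "card (within_two F `` {b} \<inter> insert a X) \<le> 4"
      proof -
        have "card (within_two F `` {b} \<inter> insert a X) \<le> card (insert a (within_two F `` {b} \<inter> X))"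
          using psubset.hyps(1) by (intro card_mono) (auto simp: X_def)
        also have "\<dots> \<le> Suc (card (within_two F `` {b} \<inter> X))"
          by (rule card_insert_le_m1) auto
        also have "\<dots> \<le> 4" using step[OF Nb] by simp
        finally show ?thesis .
      qed
      ultimately have "degenerate 4 (within_two F) (insert b (insert a X))"
        using ab by - (rule degenerate.insert, auto simp: X_def)
      moreover have "card (within_two F `` {v} \<inter> insert b (insert a X)) \<le> 4"
      proof -
        have "card (within_two F `` {v} \<inter> insert b (insert a X))
            \<le> card (F `` {v}) + (\<Sum>u \<in> F `` {v}. 1)"
        proof (rule card_within_two_le[OF fin _ sym])
          show "within_two F `` {v} \<inter> insert b (insert a X) \<subseteq> F `` {v} \<union> (\<Union>u \<in> F `` {v}. F `` {u})"
            by (auto simp: within_two_def)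
          show "v \<notin> insert b (insert a X)"
            using distinct by (simp add: X_def)
          show "card (F `` {u}) \<le> Suc 1" if "u \<in> F `` {v}" for u
            using all2 that by simp
        qed (use fin in auto)
        also have "\<dots> = 4" using Nv ab by simp
        finally show ?thesis .
      qed
      ultimately have "degenerate 4 (within_two F) (insert v (insert b (insert a X)))"
        using distinct by - (rule degenerate.insert, auto simp: X_def)
      moreover have "insert v (insert b (insert a X)) = W"
        using v inW by (auto simp: X_def)
      ultimately show ?thesis by (simp add: F_def)
    qed
  qed
qed

section \<open>Squares and the maximum average degree\<close>

text \<open>
  The distance is an infimum over walks, but costs are lengths, so an infimum of 2 is attained by a
  walk of length 2.
\<close>

lemma graph_dist_eq_2:
  assumes "pair_wf_digraph G" and "graph_dist G u v = 2"
  shows "(u, v) \<in> parcs G O parcs G"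
proof -
  interpret pair_wf_digraph G by fact
  have cost: "awalk_cost (\<lambda>_. 1) p = real (length p)" for p
    by (induction p) auto
  have inf: "(INF p \<in> {p. awalk u p v}. ereal (real (length p))) = 2"
    using assms(2) unfolding graph_dist_def \<mu>_def cost .
  then have "(INF p \<in> {p. awalk u p v}. ereal (real (length p))) < 3"
    by simp
  then obtain p where p: "awalk u p v" "ereal (real (length p)) < 3"
    by (auto simp: INF_less_iff)
  have "2 \<le> ereal (real (length p))"
    unfolding inf[symmetric] using p(1) by (intro INF_lower) simp
  with p(2) have "length p = 2"
    by simp
  then obtain e e' where "p = [e, e']"
    by (auto simp: numeral_2_eq_2 length_Suc_conv)
  with p(1) show ?thesis
    by (cases e; cases e') (auto simp: awalk_Cons_iff awalk_Nil_iff)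
qed

lemma card_parcs_le:
  assumes "finite (parcs H)"
  shows "card (parcs H) \<le> 2 * card (uedges H)"
proof -
  define arcs_on where "arcs_on e = {p. {fst p, snd p} = e}" for e :: "'a set"
  have image: "uedges H = (\<lambda>p. {fst p, snd p}) ` parcs H"
    unfolding uedges_def image_def by (metis (lifting) fst_conv prod.collapse snd_conv)
  then have fin: "finite (uedges H)"
    using assms by simp
  have two: "finite (arcs_on e) \<and> card (arcs_on e) \<le> 2" if "e \<in> uedges H" for e
  proof -
    obtain u v where "e = {u, v}"
      using \<open>e \<in> uedges H\<close> by (auto simp: uedges_def)
    then have "arcs_on e = {(u, v), (v, u)}"
      by (auto simp: arcs_on_def doubleton_eq_iff)
    moreover have "card {(u, v), (v, u)} \<le> 2"
      using card_length[of "[(u, v), (v, u)]"] by simp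
    ultimately show ?thesis
      by (metis finite.emptyI finite_insert)
  qed
  have "parcs H \<subseteq> (\<Union>e \<in> uedges H. arcs_on e)"
    by (auto simp: image arcs_on_def)
  then have "card (parcs H) \<le> card (\<Union>e \<in> uedges H. arcs_on e)"
    using fin two by (intro card_mono) auto
  also have "\<dots> \<le> (\<Sum>e \<in> uedges H. card (arcs_on e))"
    by (rule card_UN_le[OF fin])
  also have "\<dots> \<le> (\<Sum>e \<in> uedges H. 2)"
    by (rule sum_mono) (use two in auto)
  finally show ?thesis by simp
qed

lemma average_degree_le_mad:
  assumes "pair_graph G" and "X \<subseteq> pverts G" and "X \<noteq> {}"
  shows "real (card (parcs G \<inter> X \<times> X)) / real (card X) \<le> mad G"
proof -
  interpret G: pair_graph G by fact
  define H where "H = \<lparr>pverts = X, parcs = parcs G \<inter> X \<times> X\<rparr>"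
  have finX: "finite X"
    using G.pair_finite_verts assms(2) by (rule rev_finite_subset)
  interpret H: pair_graph H
  proof
    show "symmetric (with_proj H)"
      using G.pair_sym_arcs by (auto simp: H_def symmetric_def sym_def)
  qed (use finX G.pair_finite_arcs G.no_loops' in \<open>auto simp: H_def\<close>)
  have sub: "subgraph (with_proj H) (with_proj G)"
    using assms(2) G.wf_digraph_axioms H.wf_digraph_axioms
    by (auto simp: subgraph_def H_def compatible_def)
  define S where "S = {2 * real (card (uedges H)) / real (card (pverts H)) | H.
     pair_graph H \<and> subgraph (with_proj H) (with_proj G) \<and> pverts H \<noteq> {}}"
  \<comment> \<open>the maximum in \<open>mad\<close> only bounds the elements of \<open>S\<close> once \<open>S\<close> is known to be finite\<close>
  have "S \<subseteq> (\<lambda>(V, E). 2 * real (card (uedges \<lparr>pverts = V, parcs = E\<rparr>)) / real (card V)) `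
      (Pow (pverts G) \<times> Pow (parcs G))"
  proof
    fix x assume "x \<in> S"
    then obtain K :: "'a pair_pre_digraph" where K: "subgraph (with_proj K) (with_proj G)"
      "x = 2 * real (card (uedges K)) / real (card (pverts K))"
      by (auto simp: S_def)
    then show "x \<in> (\<lambda>(V, E). 2 * real (card (uedges \<lparr>pverts = V, parcs = E\<rparr>)) / real (card V)) `
        (Pow (pverts G) \<times> Pow (parcs G))"
      by (intro image_eqI[of _ _ "(pverts K, parcs K)"]) (auto simp: subgraph_def uedges_def)
  qed
  then have "finite S"
    by (rule finite_subset) (use G.pair_finite_verts G.pair_finite_arcs in simp)
  moreover have "2 * real (card (uedges H)) / real (card X) \<in> S"
    unfolding S_def using sub H.pair_graph_axioms assms(3)
    by (intro CollectI exI[of _ H]) (simp add: H_def)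
  ultimately have "2 * real (card (uedges H)) / real (card X) \<le> mad G"
    unfolding mad_def S_def[symmetric] by (rule Max_ge)
  moreover have "real (card (parcs G \<inter> X \<times> X)) \<le> 2 * real (card (uedges H))"
    using card_parcs_le[OF H.pair_finite_arcs] by (simp add: H_def)
  ultimately show ?thesis
    by (meson divide_right_mono of_nat_0_le_iff order_trans)
qed

theorem theorem1:
  fixes G :: "'a pair_pre_digraph"
  assumes "pair_graph G"
    and "subcubic G"
    and "mad G < 9 / 4"
  shows "dp_chromatic_number TYPE('c) (square G) \<le> 5"
proof -
  interpret pair_graph G by fact
  have arcs: "parcs G \<inter> pverts G \<times> pverts G = parcs G"
    using in_arcsD1 in_arcsD2 by auto
  have "degenerate 4 (within_two (parcs G \<inter> pverts G \<times> pverts G)) (pverts G)"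
  proof (rule degenerate_within_two)
    show "finite (pverts G)" by (rule pair_finite_verts)
    show "sym (parcs G)" using pair_sym_arcs by (simp add: symmetric_def)
    show "irrefl (parcs G)" using no_loops' by (auto simp: irrefl_def)
    fix v assume "v \<in> pverts G"
    have "parcs G `` {v} \<inter> pverts G = snd ` out_arcs (with_proj G) v"
      using in_arcsD2 by (force simp: out_arcs_def)
    then have "card (parcs G `` {v} \<inter> pverts G) \<le> out_degree (with_proj G) v"
      unfolding out_degree_def by (simp add: card_image_le finite_out_arcs)
    also have "\<dots> \<le> 3"
      using assms(2) \<open>v \<in> pverts G\<close> by (simp add: subcubic_def)
    finally show "card (parcs G `` {v} \<inter> pverts G) \<le> 3" .
  next
    fix X assume X: "X \<subseteq> pverts G" "X \<noteq> {}"
    then have "card X > 0"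
      using finite_subset[OF _ pair_finite_verts] by (simp add: card_gt_0_iff)
    have "real (card (parcs G \<inter> X \<times> X)) / real (card X) < 9 / 4"
      using average_degree_le_mad[OF assms(1) X] assms(3) by (rule le_less_trans)
    then show "4 * card (parcs G \<inter> X \<times> X) < 9 * card X"
      using \<open>card X > 0\<close> by (simp add: pos_divide_less_eq)
  qed
  then have "degenerate 4 (parcs (square G)) (pverts (square G))"
    unfolding arcs using graph_dist_eq_2[OF pair_wf_digraph]
    by (auto simp: square_def within_two_def intro: degenerate_mono)
  then have "dp_colorable TYPE('c) 5 (square G)"
    using degenerate_imp_dp_colorable[of 4] by simp
  then show ?thesis
    unfolding dp_chromatic_number_def by (rule Least_le)
qed

end
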